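(* Let $T$ be any branching tree for the problem $\min\{f(x)\mid x\in F,\ x\in D\}$ that establishes a bound $\lambda$, i.e. $\theta(T)\ge\lambda$. Then the worst-bound heuristic can be executed (for a suitable choice of the labels it selects at eligible nodes) in such a way that at some iteration its current tree $T'$ is a branching subtree of $T$ with $\theta(T')\ge\lambda$.
   Context: Consider the problem $\min\{f(x)\mid x\in F,\ x\in D\}$, where $x=(x_1,\ldots,x_n)$, $F$ is a set, $D=D_{x_1}\times\cdots\times D_{x_n}$, and each $D_{x_j}$ is a finite nonempty domain. Branching tree: a rooted tree $T$; $P[u]$ is the path from the root to node $u$; $u$ is on level $j$ if $P[u]$ has $j-1$ arcs; a terminal node is one on level $n+1$. $T$ is a branching tree if (a) every nonterminal node $u$ is labeled with a variable $x_{j(u)}$, with distinct labels along $P[u]$; (b) the arcs from a nonleaf node $u$ to its children are associated with distinct values in $D_{x_{j(u)}}$, viewed as assignments to $x_{j(u)}$. The arcs of $P[u]$ define a partial assignment $x[u]$. A branching tree $T'$ is a branching subtree of $T$ if $T'$ is a subtree of $T$ (containing the root) and the node labels in $T'$ are the same as in $T$. Relaxation values: each node $u$ has $c_u=c(x[u])\in\mathbb{R}\cup\{\infty\}$, a function of the partial assignment alone, with $c_u\le f(x)$ for all $x\in F\cap D$ consistent with $x[u]$, $c_t\le c_u$ when $t$ is the parent of $u$, and for terminal $u$, $c_u=f(x[u])$ if $x[u]\in F$, $c_u=\infty$ otherwise. $u$ is feasible if $c_u<\infty$. An open node is a nonterminal node $u$ with fewer than $|D_{x_{j(u)}}|$ children.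 $\theta(T)=\min\{c_u: u \text{ terminal or open in } T\}$. An eligible node is an open node $u$ with $c_u=\theta(T)$. Worst-bound heuristic: start with $T$ consisting of the root only. While some open or terminal node of $T$ is feasible: if some terminal node $u$ has $c_u=\theta(T)$, stop (with bound $\theta(T)$); otherwise, for every eligible node $u$ of $T$, select a label $x_{j(u)}$ for $u$ not occurring on $P[u]$ and add to $T$ all children of $u$ (one for each value in $D_{x_{j(u)}}$), yielding the next tree. If the loop ends because no open or terminal node is feasible, the problem is infeasible. *)

theory Defs
  imports "HOL-Library.Extended_Real" "HOL-Library.FuncSet" "HOL-Library.Sublist"
begin

text \<open>
  The variables are \<open>x\<^sub>1, \<dots>, x\<^sub>n\<close>, represented by their indices in \<open>{1..n}\<close>; \<open>D j\<close> is the
  domain of \<open>x\<^sub>j\<close>, and the product of the domains is \<open>Pi\<^sub>E {1..n} D\<close>.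

  Since the arcs leaving a node carry distinct values, a node is identified with the list of
  values on the arcs from the root to it.  Thus the root is \<open>[]\<close>, the children of \<open>u\<close> have the
  form \<open>u @ [v]\<close>, and the nodes on the path from the root to \<open>u\<close> are \<open>prefixes u\<close>.
  The value of \<open>label\<close> is meaningless at terminal nodes and outside \<open>nodes\<close>.
\<close>

datatype 'v btree = BTree (nodes: "'v list set") (label: "'v list \<Rightarrow> nat")

definition level :: "'v list \<Rightarrow> nat" where
  "level u = length u + 1"

definition terminal :: "nat \<Rightarrow> 'v list \<Rightarrow> bool" where
  "terminal n u \<longleftrightarrow> level u = n + 1"

definition children :: "'v btree \<Rightarrow> 'v list \<Rightarrow> 'v list set" where
  "children T u = {w \<in> nodes T. \<exists>v. w = u @ [v]}"

definition branching_tree :: "nat \<Rightarrow> (nat \<Rightarrow> 'v set) \<Rightarrow> 'v btree \<Rightarrow> bool" where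
  "branching_tree n D T \<longleftrightarrow>
     [] \<in> nodes T \<and>
     (\<forall>u v. u @ [v] \<in> nodes T \<longrightarrow> u \<in> nodes T) \<and>
     (\<forall>u \<in> nodes T. level u \<le> n + 1) \<and>
     (\<forall>u \<in> nodes T. \<not> terminal n u \<longrightarrow>
        label T u \<in> {1..n} \<and> distinct (map (label T) (prefixes u))) \<and>
     (\<forall>u v. u @ [v] \<in> nodes T \<longrightarrow> v \<in> D (label T u))"

definition branching_subtree :: "nat \<Rightarrow> (nat \<Rightarrow> 'v set) \<Rightarrow> 'v btree \<Rightarrow> 'v btree \<Rightarrow> bool" where
  "branching_subtree n D T' T \<longleftrightarrow>
     branching_tree n D T' \<and> branching_tree n D T \<and> nodes T' \<subseteq> nodes T \<and>
     (\<forall>u \<in> nodes T'. \<not> terminal n u \<longrightarrow> label T' u = label T u)"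

text \<open>
  The partial assignment \<open>x[u]\<close>: the \<open>i\<close>-th value in \<open>u\<close> is given to the label of the \<open>i\<close>-th node
  on the path.  \<open>prefixes u\<close> also contains \<open>u\<close> itself as its last element, which \<open>zip\<close> drops.
\<close>

definition path_assignment :: "'v btree \<Rightarrow> 'v list \<Rightarrow> (nat \<rightharpoonup> 'v)" where
  "path_assignment T u = map_of (zip (map (label T) (prefixes u)) u)"

definition full_assignment :: "nat \<Rightarrow> (nat \<rightharpoonup> 'v) \<Rightarrow> (nat \<Rightarrow> 'v)" where
  "full_assignment n \<sigma> = (\<lambda>j\<in>{1..n}. the (\<sigma> j))"

definition consistent :: "(nat \<rightharpoonup> 'v) \<Rightarrow> (nat \<Rightarrow> 'v) \<Rightarrow> bool" where
  "consistent \<sigma> x \<longleftrightarrow> (\<forall>j \<in> dom \<sigma>. \<sigma> j = Some (x j))"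

definition node_value :: "((nat \<rightharpoonup> 'v) \<Rightarrow> ereal) \<Rightarrow> 'v btree \<Rightarrow> 'v list \<Rightarrow> ereal" where
  "node_value c T u = c (path_assignment T u)"

definition relaxation_values ::
    "nat \<Rightarrow> (nat \<Rightarrow> 'v set) \<Rightarrow> (nat \<Rightarrow> 'v) set \<Rightarrow> ((nat \<Rightarrow> 'v) \<Rightarrow> real) \<Rightarrow>
     ((nat \<rightharpoonup> 'v) \<Rightarrow> ereal) \<Rightarrow> bool" where
  "relaxation_values n D F f c \<longleftrightarrow>
     (\<forall>T. branching_tree n D T \<longrightarrow> (\<forall>u \<in> nodes T.
        node_value c T u \<noteq> -\<infinity> \<and>
        (\<forall>x \<in> F \<inter> Pi\<^sub>E {1..n} D.
           consistent (path_assignment T u) x \<longrightarrow> node_value c T u \<le> ereal (f x)) \<and>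
        (\<forall>w \<in> children T u. node_value c T u \<le> node_value c T w) \<and>
        (terminal n u \<longrightarrow>
           node_value c T u =
             (let x = full_assignment n (path_assignment T u)
              in if x \<in> F then ereal (f x) else \<infinity>))))"

definition open_node :: "nat \<Rightarrow> (nat \<Rightarrow> 'v set) \<Rightarrow> 'v btree \<Rightarrow> 'v list \<Rightarrow> bool" where
  "open_node n D T u \<longleftrightarrow>
     u \<in> nodes T \<and> \<not> terminal n u \<and> card (children T u) < card (D (label T u))"

definition theta ::
    "nat \<Rightarrow> (nat \<Rightarrow> 'v set) \<Rightarrow> ((nat \<rightharpoonup> 'v) \<Rightarrow> ereal) \<Rightarrow> 'v btree \<Rightarrow> ereal" where
  "theta n D c T =
     Min (node_value c T ` {u \<in> nodes T. terminal n u \<or> open_node n D T u})"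

definition eligible ::
    "nat \<Rightarrow> (nat \<Rightarrow> 'v set) \<Rightarrow> ((nat \<rightharpoonup> 'v) \<Rightarrow> ereal) \<Rightarrow> 'v btree \<Rightarrow> 'v list \<Rightarrow> bool" where
  "eligible n D c T u \<longleftrightarrow> open_node n D T u \<and> node_value c T u = theta n D c T"

definition feasible :: "((nat \<rightharpoonup> 'v) \<Rightarrow> ereal) \<Rightarrow> 'v btree \<Rightarrow> 'v list \<Rightarrow> bool" where
  "feasible c T u \<longleftrightarrow> node_value c T u < \<infinity>"

text \<open>
  In a branching tree every nonterminal node has a label, whereas the worst-bound heuristic only
  selects the label of a node when it expands that node.  Hence a node not yet expanded carries a
  provisional label, subject only to the requirement that the current tree be a branching tree;
  the label is replaced by the selected one when the node is expanded.  Such a node is a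
  leaf, so its provisional label affects neither its openness nor any partial assignment.
\<close>

definition wb_initial :: "nat \<Rightarrow> (nat \<Rightarrow> 'v set) \<Rightarrow> 'v btree \<Rightarrow> bool" where
  "wb_initial n D T \<longleftrightarrow> branching_tree n D T \<and> nodes T = {[]}"

definition wb_halts ::
    "nat \<Rightarrow> (nat \<Rightarrow> 'v set) \<Rightarrow> ((nat \<rightharpoonup> 'v) \<Rightarrow> ereal) \<Rightarrow> 'v btree \<Rightarrow> bool" where
  "wb_halts n D c T \<longleftrightarrow>
     \<not> (\<exists>u \<in> nodes T. (open_node n D T u \<or> terminal n u) \<and> feasible c T u) \<or>
     (\<exists>u \<in> nodes T. terminal n u \<and> node_value c T u = theta n D c T)"

definition wb_step ::
    "nat \<Rightarrow> (nat \<Rightarrow> 'v set) \<Rightarrow> ((nat \<rightharpoonup> 'v) \<Rightarrow> ereal) \<Rightarrow> 'v btree \<Rightarrow> 'v btree \<Rightarrow> bool" where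
  "wb_step n D c T T' \<longleftrightarrow>
     \<not> wb_halts n D c T \<and>
     (\<forall>u. eligible n D c T u \<longrightarrow>
        label T' u \<in> {1..n} - label T ` {w. strict_prefix w u}) \<and>
     (\<forall>u \<in> nodes T. \<not> eligible n D c T u \<longrightarrow> label T' u = label T u) \<and>
     nodes T' = nodes T \<union> {u @ [v] | u v. eligible n D c T u \<and> v \<in> D (label T' u)} \<and>
     branching_tree n D T'"

text \<open>A complete execution, given by the list of its successive current trees.\<close>

definition wb_execution ::
    "nat \<Rightarrow> (nat \<Rightarrow> 'v set) \<Rightarrow> ((nat \<rightharpoonup> 'v) \<Rightarrow> ereal) \<Rightarrow> 'v btree list \<Rightarrow> bool" where
  "wb_execution n D c Ts \<longleftrightarrow>
     Ts \<noteq> [] \<and> wb_initial n D (hd Ts) \<and> successively (wb_step n D c) Ts \<and>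
     wb_halts n D c (last Ts)"

end

theory Submission
  imports Defs
begin

text \<open>
  Let the heuristic always select the labels of \<open>T\<close>.  As long as its tree \<open>B\<close> is a subtree of \<open>T\<close>
  with \<open>theta B < b\<close>, it cannot halt, and no eligible node of \<open>B\<close> is terminal or open in \<open>T\<close>,
  because it would pull \<open>theta T\<close> below \<open>b\<close>.  So \<open>T\<close> contains all children of the eligible nodes and
  the next tree is again a subtree of \<open>T\<close>.  Every step strictly enlarges a tree inside the finite
  set of value sequences of length at most \<open>n\<close>, so \<open>theta B \<ge> b\<close> is reached, after which
  the execution is completed with arbitrary labels.
\<close>

section \<open>Paths and labels in a branching tree\<close>

text \<open>Distinctness of the label list along a path is injectivity on the set of prefixes. The
  first form is the one that \<open>wb_step\<close> demands of a selected label, the second is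
  convenient for comparing labellings.\<close>

lemma branching_tree_label:
  assumes "branching_tree n D T" "u \<in> nodes T" "\<not> terminal n u"
  shows "label T u \<in> {1..n} - label T ` {w. strict_prefix w u}"
    and "inj_on (label T) {w. prefix w u}"
proof -
  have "label T u \<in> {1..n}" and "distinct (map (label T) (prefixes u))"
    using assms unfolding branching_tree_def by blast+
  then show inj: "inj_on (label T) {w. prefix w u}"
    by (simp add: distinct_map set_prefixes_eq)
  have "label T u \<noteq> label T w" if "strict_prefix w u" for w
    using inj_onD[OF inj, of u w] that by (auto simp: strict_prefix_def)
  with \<open>label T u \<in> {1..n}\<close> show "label T u \<in> {1..n} - label T ` {w. strict_prefix w u}"
    by blast
qed

lemma branching_tree_prefix:
  assumes "branching_tree n D T" "u \<in> nodes T" "prefix w u"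
  shows "w \<in> nodes T"
  using assms(3,2)
proof (induction u rule: rev_induct)
  case (snoc v u)
  then show ?case
    using assms(1) unfolding branching_tree_def by (metis prefix_snoc)
qed simp

lemma branching_tree_parent:
  assumes "branching_tree n D T" "u @ [v] \<in> nodes T"
  shows "u \<in> nodes T" "\<not> terminal n u" "label T u \<in> {1..n}" "v \<in> D (label T u)"
proof -
  show u: "u \<in> nodes T" and "v \<in> D (label T u)"
    using assms unfolding branching_tree_def by blast+
  have "level (u @ [v]) \<le> n + 1"
    using assms unfolding branching_tree_def by blast
  then show t: "\<not> terminal n u"
    by (simp add: level_def terminal_def)
  show "label T u \<in> {1..n}"
    using branching_tree_label(1)[OF assms(1) u t] by blast
qed

text \<open>Apart from the root and closure under parents, all conditions on a branching tree are
  universal statements about its nodes and are inherited by subsets.\<close>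

lemma branching_tree_restrict:
  assumes "branching_tree n D T" "N \<subseteq> nodes T" "[] \<in> N" "\<And>u v. u @ [v] \<in> N \<Longrightarrow> u \<in> N"
  shows "branching_tree n D (BTree N (label T))"
  unfolding branching_tree_def btree.sel
proof (intro conjI)
  show "[] \<in> N" "\<forall>u v. u @ [v] \<in> N \<longrightarrow> u \<in> N"
    using assms(3,4) by blast+
qed (use assms(1,2) in \<open>unfold branching_tree_def, blast+\<close>)

section \<open>Finiteness of branching trees\<close>

lemma length_branching_tree:
  assumes "branching_tree n D T" "u \<in> nodes T"
  shows "length u \<le> n"
  using assms unfolding branching_tree_def level_def by auto

text \<open>A common finite superset of the nodes of all branching trees. The number of its elements
  missing from the current tree serves as termination measure.\<close>

definition all_nodes :: "nat \<Rightarrow> (nat \<Rightarrow> 'v set) \<Rightarrow> 'v list set" where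
  "all_nodes n D = {u. set u \<subseteq> (\<Union>j\<in>{1..n}. D j) \<and> length u \<le> n}"

lemma branching_tree_subset_all_nodes:
  assumes "branching_tree n D T"
  shows "nodes T \<subseteq> all_nodes n D"
proof
  fix u assume "u \<in> nodes T"
  moreover from this have "set u \<subseteq> (\<Union>j\<in>{1..n}. D j)"
  proof (induction u rule: rev_induct)
    case (snoc v u)
    then show ?case
      using branching_tree_parent[OF assms snoc.prems] by auto
  qed simp
  ultimately show "u \<in> all_nodes n D"
    using length_branching_tree[OF assms] by (simp add: all_nodes_def)
qed

lemma finite_all_nodes:
  assumes "\<forall>j \<in> {1..n}. finite (D j)"
  shows "finite (all_nodes n D)"
  unfolding all_nodes_def using assms by (intro finite_lists_length_le) auto

lemma finite_nodes:
  assumes "\<forall>j \<in> {1..n}. finite (D j)" "branching_tree n D T"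
  shows "finite (nodes T)"
  using finite_subset[OF branching_tree_subset_all_nodes finite_all_nodes] assms by blast

section \<open>Open nodes and the bound \<open>theta\<close>\<close>

text \<open>The children of \<open>u\<close> correspond bijectively to a subset of the finite domain
  of its label, so equal cardinality means equality. This replaces the counting in
  \<open>open_node\<close> by membership.\<close>

lemma children_full_iff:
  assumes "branching_tree n D T" "\<forall>j \<in> {1..n}. finite (D j)" "u \<in> nodes T" "\<not> terminal n u"
  shows "\<not> open_node n D T u \<longleftrightarrow> (\<forall>v \<in> D (label T u). u @ [v] \<in> nodes T)"
proof -
  let ?V = "{v. u @ [v] \<in> nodes T}"
  have "children T u = (\<lambda>v. u @ [v]) ` ?V"
    by (auto simp: children_def)
  then have card: "card (children T u) = card ?V"
    by (simp add: card_image inj_on_def)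
  have sub: "?V \<subseteq> D (label T u)"
    using branching_tree_parent(4)[OF assms(1)] by blast
  have fin: "finite (D (label T u))"
    using branching_tree_label(1)[OF assms(1,3,4)] assms(2) by blast
  have "\<not> open_node n D T u \<longleftrightarrow> ?V = D (label T u)"
    using card_seteq[OF fin sub] assms(3,4) card by (auto simp: open_node_def)
  with sub show ?thesis by blast
qed

text \<open>A longest node of a tree has no children.\<close>

lemma open_or_terminal_exists:
  assumes "branching_tree n D T" "\<forall>j \<in> {1..n}. finite (D j) \<and> D j \<noteq> {}"
  shows "\<exists>u \<in> nodes T. terminal n u \<or> open_node n D T u"
proof -
  have fin: "finite (nodes T)"
    using finite_nodes assms by blast
  have ne: "nodes T \<noteq> {}"
    using assms(1) unfolding branching_tree_def by blast
  have "Max (length ` nodes T) \<in> length ` nodes T"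
    using fin ne by simp
  then obtain u where u: "u \<in> nodes T" "length u = Max (length ` nodes T)"
    by auto
  have leaf: "u @ [v] \<notin> nodes T" for v
    using Max_ge[OF finite_imageI[OF fin] imageI, of "u @ [v]" length] u(2) by auto
  have "open_node n D T u" if "\<not> terminal n u"
  proof -
    have "D (label T u) \<noteq> {}"
      using branching_tree_label(1)[OF assms(1) u(1) that] assms(2) by blast
    then show ?thesis
      using children_full_iff[OF assms(1) _ u(1) that] assms(2) leaf by blast
  qed
  with u(1) show ?thesis by blast
qed

lemma theta_attained:
  assumes "branching_tree n D T" "\<forall>j \<in> {1..n}. finite (D j) \<and> D j \<noteq> {}"
  obtains u where "u \<in> nodes T" "terminal n u \<or> open_node n D T u"
    "node_value c T u = theta n D c T"
proof -
  let ?A = "{u \<in> nodes T. terminal n u \<or> open_node n D T u}"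
  have "finite (nodes T)"
    using finite_nodes assms by blast
  then have "Min (node_value c T ` ?A) \<in> node_value c T ` ?A"
    using open_or_terminal_exists[OF assms] by (intro Min_in) auto
  then show ?thesis
    unfolding theta_def[symmetric] using that by fastforce
qed

lemma theta_le:
  assumes "branching_tree n D T" "\<forall>j \<in> {1..n}. finite (D j)"
    and "u \<in> nodes T" "terminal n u \<or> open_node n D T u"
  shows "theta n D c T \<le> node_value c T u"
  unfolding theta_def using finite_nodes[OF assms(2,1)] assms(3,4) by (intro Min_le) auto

section \<open>Eligible nodes and steps of the heuristic\<close>

text \<open>The minimum \<open>theta\<close> is attained at a terminal or an open node, and
  attainment at a terminal node would halt the heuristic.\<close>

lemma eligible_exists:
  assumes "branching_tree n D T" "\<forall>j \<in> {1..n}. finite (D j) \<and> D j \<noteq> {}" "\<not> wb_halts n D c T"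
  shows "\<exists>u. eligible n D c T u"
  using theta_attained[OF assms(1,2), of c] assms(3) unfolding wb_halts_def eligible_def by metis

lemma eligibleD:
  assumes "eligible n D c T u"
  shows "u \<in> nodes T" "\<not> terminal n u"
  using assms unfolding eligible_def open_node_def by auto

text \<open>
  The label condition excludes relabelling a partially expanded eligible node by a variable
  whose domain is exactly the set of values already branched on.
\<close>

lemma wb_step_nodes_psubset:
  assumes "branching_tree n D B" "\<forall>j \<in> {1..n}. finite (D j) \<and> D j \<noteq> {}" "wb_step n D c B B'"
    and "\<forall>u \<in> nodes B. label B' u = label B u"
  shows "nodes B \<subset> nodes B'"
proof -
  obtain u where u: "eligible n D c B u"
    using eligible_exists[OF assms(1,2), of c] assms(3) by (auto simp: wb_step_def)
  have N: "nodes B' = nodes B \<union> {u @ [v] | u v. eligible n D c B u \<and> v \<in> D (label B' u)}"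
    using assms(3) unfolding wb_step_def by blast
  have "open_node n D B u"
    using u unfolding eligible_def by blast
  then obtain v where "v \<in> D (label B u)" "u @ [v] \<notin> nodes B"
    using children_full_iff[OF assms(1) _ eligibleD[OF u]] assms(2) by auto
  moreover have "label B' u = label B u"
    using assms(4) eligibleD(1)[OF u] by blast
  ultimately show ?thesis
    using N u by auto
qed

text \<open>The nodes added by a step receive provisional labels that do not occur above them.\<close>

lemma wb_step_exists:
  fixes B :: "'v btree"
  assumes "branching_tree n D B" "\<forall>j \<in> {1..n}. finite (D j) \<and> D j \<noteq> {}" "\<not> wb_halts n D c B"
  shows "\<exists>B'. wb_step n D c B B' \<and> (\<forall>u \<in> nodes B. label B' u = label B u)"
proof -
  define fresh where "fresh w = {1..n} - label B ` {z. strict_prefix z w}" for w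
  \<comment> \<open>Eligible nodes keep their provisional label as the selected one. At a new
    terminal node the choice may be arbitrary, since no condition concerns labels there.\<close>
  define lab where "lab w = (if w \<in> nodes B then label B w else SOME j. j \<in> fresh w)" for w
  define New where "New = {u @ [v] | u v. eligible n D c B u \<and> v \<in> D (label B u)}"
  define N where "N = nodes B \<union> New"
  have lab_old: "lab w = label B w" if "w \<in> nodes B" for w
    using that by (simp add: lab_def)
  have root: "[] \<in> nodes B"
    using assms(1) unfolding branching_tree_def by blast
  have parent: "u \<in> nodes B \<and> \<not> terminal n u \<and> v \<in> D (label B u)" if "u @ [v] \<in> N" for u v
    using that branching_tree_parent[OF assms(1)] unfolding N_def New_def by (auto dest: eligibleD)
  have level: "level w \<le> n + 1" if "w \<in> N" for w
  proof (cases w rule: rev_cases)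
    case Nil
    then show ?thesis by (simp add: level_def)
  next
    case (snoc u v)
    with parent[of u v] that have u: "u \<in> nodes B" "\<not> terminal n u" by auto
    then show ?thesis
      using length_branching_tree[OF assms(1) u(1)] snoc by (simp add: level_def terminal_def)
  qed
  have good: "lab w \<in> {1..n} \<and> inj_on lab {z. prefix z w}" if w: "w \<in> N" "\<not> terminal n w" for w
  proof (cases "w \<in> nodes B")
    case True
    have "inj_on lab {z. prefix z w} \<longleftrightarrow> inj_on (label B) {z. prefix z w}"
      using branching_tree_prefix[OF assms(1) True] by (intro inj_on_cong) (auto simp: lab_old)
    then show ?thesis
      using branching_tree_label[OF assms(1) True w(2)] True by (simp add: lab_old)
  next
    case False
    then obtain u v where uv: "w = u @ [v]" "u \<in> nodes B" "\<not> terminal n u"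
      using w(1) parent unfolding N_def New_def by blast
    have above: "{z. strict_prefix z w} = set (prefixes u)"
      unfolding uv(1) strict_prefix_def by (auto simp: prefix_snoc dest: prefix_length_le)
    \<comment> \<open>Pigeonhole: \<open>prefixes u\<close> counts both the root and
      \<open>u\<close>, so it has exactly \<open>length w\<close> entries, and a nonterminal
      \<open>w\<close> has length below \<open>n\<close>. Hence some variable does not occur above
      \<open>w\<close>.\<close>
    have "card (label B ` {z. strict_prefix z w}) \<le> length (prefixes u)"
      unfolding above using card_image_le card_length by (meson List.finite_set le_trans)
    also have "\<dots> = length w"
      by (simp add: uv(1))
    also have "\<dots> < card {1..n}"
      using level[OF w(1)] w(2) by (simp add: level_def terminal_def)
    finally have "fresh w \<noteq> {}"
      unfolding fresh_def above by (metis Diff_eq_empty_iff List.finite_set card_mono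
          finite_imageI not_less)
    then have fresh: "lab w \<in> fresh w"
      using False by (simp add: lab_def some_in_eq)
    have old: "set (prefixes u) \<subseteq> nodes B"
      using branching_tree_prefix[OF assms(1) uv(2)] by auto
    have "inj_on lab (set (prefixes u)) \<longleftrightarrow> inj_on (label B) (set (prefixes u))"
      using old by (intro inj_on_cong) (auto simp: lab_old)
    moreover have "inj_on (label B) (set (prefixes u))"
      using branching_tree_label(2)[OF assms(1) uv(2,3)] by (simp add: set_prefixes_eq)
    moreover have "lab w \<notin> lab ` set (prefixes u)"
    proof -
      have "lab ` set (prefixes u) = label B ` set (prefixes u)"
        using old by (intro image_cong) (auto simp: lab_old)
      then show ?thesis
        using fresh by (simp add: fresh_def above[symmetric])
    qed
    moreover have "{z. prefix z w} = insert w (set (prefixes u))"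
      by (auto simp: uv(1))
    ultimately have "inj_on lab {z. prefix z w}"
      by auto
    with fresh show ?thesis by (simp add: fresh_def)
  qed
  have "branching_tree n D (BTree N lab)"
    unfolding branching_tree_def
  proof (intro conjI ballI allI impI; simp only: btree.sel)
    show "[] \<in> N" using root by (simp add: N_def)
    show "u \<in> N" if "u @ [v] \<in> N" for u v
      using parent[OF that] by (simp add: N_def)
    show "level w \<le> n + 1" if "w \<in> N" for w
      using level[OF that] .
    show "lab w \<in> {1..n}" if "w \<in> N" "\<not> terminal n w" for w
      using good[OF that] by blast
    show "distinct (map lab (prefixes w))" if "w \<in> N" "\<not> terminal n w" for w
      using good[OF that] by (simp add: distinct_map distinct_prefixes set_prefixes_eq)
    show "v \<in> D (lab u)" if "u @ [v] \<in> N" for u v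
      using parent[OF that] by (simp add: lab_old)
  qed
  moreover have "lab u \<in> {1..n} - label B ` {w. strict_prefix w u}"
    if "eligible n D c B u" for u
    using branching_tree_label(1)[OF assms(1) eligibleD[OF that]] eligibleD(1)[OF that]
    by (simp add: lab_old)
  moreover have "N = nodes B \<union> {u @ [v] | u v. eligible n D c B u \<and> v \<in> D (lab u)}"
    unfolding N_def New_def using lab_old[OF eligibleD(1)] by (auto 0 4)
  ultimately have "wb_step n D c B (BTree N lab)"
    using assms(3) lab_old unfolding wb_step_def by simp
  then show ?thesis
    using lab_old by auto
qed

section \<open>Complete runs from an arbitrary tree\<close>

text \<open>Differs from \<open>wb_execution\<close> in that the first tree is a parameter, which
  lets inductions proceed from the current tree.\<close>

definition wb_run ::
    "nat \<Rightarrow> (nat \<Rightarrow> 'v set) \<Rightarrow> ((nat \<rightharpoonup> 'v) \<Rightarrow> ereal) \<Rightarrow> 'v btree \<Rightarrow> 'v btree list \<Rightarrow> bool" where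
  "wb_run n D c B Ts \<longleftrightarrow>
     Ts \<noteq> [] \<and> hd Ts = B \<and> successively (wb_step n D c) Ts \<and> wb_halts n D c (last Ts)"

lemma wb_run_Cons:
  assumes "wb_step n D c B B'" "wb_run n D c B' Ts"
  shows "wb_run n D c B (B # Ts)"
  using assms by (auto simp: wb_run_def successively_Cons)

text \<open>The nodes gained by a step again lie in \<open>all_nodes n D\<close>, so they leave the
  complement.\<close>

lemma wb_step_measure:
  assumes "branching_tree n D B" "\<forall>j \<in> {1..n}. finite (D j) \<and> D j \<noteq> {}" "wb_step n D c B B'"
    and "\<forall>u \<in> nodes B. label B' u = label B u"
  shows "card (all_nodes n D - nodes B') < card (all_nodes n D - nodes B)"
proof (rule psubset_card_mono)
  show "finite (all_nodes n D - nodes B)"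
    using finite_all_nodes assms(2) by blast
  have "nodes B' \<subseteq> all_nodes n D"
    using assms(3) branching_tree_subset_all_nodes unfolding wb_step_def by blast
  then show "all_nodes n D - nodes B' \<subset> all_nodes n D - nodes B"
    using wb_step_nodes_psubset[OF assms] by blast
qed

lemma wb_run_exists:
  assumes "branching_tree n D B" "\<forall>j \<in> {1..n}. finite (D j) \<and> D j \<noteq> {}"
  shows "\<exists>Ts. wb_run n D c B Ts"
  using assms(1)
proof (induction "card (all_nodes n D - nodes B)" arbitrary: B rule: less_induct)
  case less
  show ?case
  proof (cases "wb_halts n D c B")
    case True
    then have "wb_run n D c B [B]"
      by (simp add: wb_run_def)
    then show ?thesis ..
  next
    case False
    then obtain B' where B': "wb_step n D c B B'" "\<forall>u \<in> nodes B. label B' u = label B u"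
      using wb_step_exists[OF less.prems assms(2)] by blast
    moreover from B'(1) have "branching_tree n D B'"
      by (simp add: wb_step_def)
    ultimately show ?thesis
      using less.hyps[OF wb_step_measure[OF less.prems assms(2)]] wb_run_Cons by blast
  qed
qed

section \<open>Runs that stay inside \<open>T\<close>\<close>

lemma branching_subtree_restrict:
  assumes "branching_tree n D T" "branching_tree n D (BTree N (label T))" "N \<subseteq> nodes T"
  shows "branching_subtree n D (BTree N (label T)) T"
  using assms by (simp add: branching_subtree_def)

text \<open>A path assignment depends on the labelling and the path only, not on which other nodes
  are present.\<close>

lemma node_value_restrict: "node_value c (BTree N (label T)) = node_value c T"
  by (simp add: node_value_def path_assignment_def fun_eq_iff)

text \<open>Being below \<open>theta n D c T\<close>, the bound of the smaller tree is finite or at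
  least less than \<infinity>, so a node attaining it is feasible. A terminal node of the smaller
  tree is terminal in \<open>T\<close> too, hence its value is at least \<open>theta n D c T\<close>
  and cannot attain the smaller bound.\<close>

lemma not_halts_below_bound:
  assumes dom: "\<forall>j \<in> {1..n}. finite (D j) \<and> D j \<noteq> {}"
    and T: "branching_tree n D T" and B: "branching_tree n D (BTree N (label T))"
    and sub: "N \<subseteq> nodes T" and less: "theta n D c (BTree N (label T)) < theta n D c T"
  shows "\<not> wb_halts n D c (BTree N (label T))"
proof -
  let ?B = "BTree N (label T)"
  obtain u where u: "u \<in> nodes ?B" "terminal n u \<or> open_node n D ?B u"
    "node_value c ?B u = theta n D c ?B"
    using theta_attained[OF B dom] by blast
  have "theta n D c ?B < \<infinity>"
    using less by (rule order_less_le_trans) simp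
  with u have "\<exists>u \<in> nodes ?B. (open_node n D ?B u \<or> terminal n u) \<and> feasible c ?B u"
    unfolding feasible_def by metis
  moreover have "node_value c ?B w \<noteq> theta n D c ?B" if "w \<in> nodes ?B" "terminal n w" for w
    using theta_le[OF T _ _ disjI1[OF that(2)], of c] dom sub less that(1)
    by (auto simp: node_value_restrict)
  ultimately show ?thesis
    unfolding wb_halts_def by blast
qed

lemma wb_step_in_tree:
  assumes dom: "\<forall>j \<in> {1..n}. finite (D j) \<and> D j \<noteq> {}"
    and T: "branching_tree n D T" and B: "branching_tree n D (BTree N (label T))"
    and sub: "N \<subseteq> nodes T" and less: "theta n D c (BTree N (label T)) < theta n D c T"
  shows "\<exists>N' \<subseteq> nodes T. wb_step n D c (BTree N (label T)) (BTree N' (label T))"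
proof -
  let ?B = "BTree N (label T)"
  define N' where
    "N' = N \<union> {u @ [v] | u v. eligible n D c ?B u \<and> v \<in> D (label T u)}"
  have elig: "u \<in> N" "\<not> terminal n u" if "eligible n D c ?B u" for u
    using eligibleD[OF that] by auto
  have full: "u @ [v] \<in> nodes T" if u: "eligible n D c ?B u" and v: "v \<in> D (label T u)" for u v
  proof -
    have uT: "u \<in> nodes T"
      using elig(1)[OF u] sub by blast
    \<comment> \<open>If \<open>u\<close> were open in \<open>T\<close>, its value would be at least
      \<open>theta n D c T\<close>. So \<open>T\<close> has expanded \<open>u\<close>
      completely.\<close>
    have "node_value c T u < theta n D c T"
      using u less by (simp add: eligible_def node_value_restrict)
    then have "\<not> open_node n D T u"
      using theta_le[OF T _ uT, of c] dom by force
    then show ?thesis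
      using children_full_iff[OF T _ uT elig(2)[OF u]] dom v by blast
  qed
  have N': "N' \<subseteq> nodes T"
    using sub full unfolding N'_def by blast
  have "branching_tree n D (BTree N' (label T))"
  proof (rule branching_tree_restrict[OF T N'])
    show "[] \<in> N'"
      using B unfolding branching_tree_def N'_def by simp
    show "u \<in> N'" if "u @ [v] \<in> N'" for u v
      using that branching_tree_parent(1)[OF B] elig(1) unfolding N'_def by auto
  qed
  moreover have "label T u \<in> {1..n} - label T ` {w. strict_prefix w u}"
    if "eligible n D c ?B u" for u
    using branching_tree_label(1)[OF B eligibleD[OF that]] by simp
  ultimately have "wb_step n D c ?B (BTree N' (label T))"
    using not_halts_below_bound[OF assms] by (simp add: wb_step_def N'_def)
  with N' show ?thesis by blast
qed

text \<open>With the labelling of \<open>T\<close> fixed, the current tree is determined by its node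
  set \<open>N\<close>, and the induction is on the number of nodes missing from \<open>N\<close>.
  Once the bound of \<open>T\<close> is reached, any completion of the run will do.\<close>

lemma wb_run_reaches_bound:
  assumes "\<forall>j \<in> {1..n}. finite (D j) \<and> D j \<noteq> {}"
    and "branching_tree n D T" "branching_tree n D (BTree N (label T))" "N \<subseteq> nodes T"
  shows "\<exists>Ts. wb_run n D c (BTree N (label T)) Ts \<and>
           (\<exists>B \<in> set Ts. branching_subtree n D B T \<and> theta n D c T \<le> theta n D c B)"
  using assms(3,4)
proof (induction "card (all_nodes n D - N)" arbitrary: N rule: less_induct)
  case less
  let ?B = "BTree N (label T)"
  show ?case
  proof (cases "theta n D c T \<le> theta n D c ?B")
    case True
    obtain Ts where Ts: "wb_run n D c ?B Ts"
      using wb_run_exists[OF less.prems(1) assms(1)] by blast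
    then have "?B \<in> set Ts"
      unfolding wb_run_def by (metis hd_in_set)
    then show ?thesis
      using Ts True branching_subtree_restrict[OF assms(2) less.prems] by blast
  next
    case False
    then obtain N' where N': "N' \<subseteq> nodes T" and step: "wb_step n D c ?B (BTree N' (label T))"
      using wb_step_in_tree[OF assms(1,2) less.prems, of c] by (auto simp: not_le)
    have "card (all_nodes n D - N') < card (all_nodes n D - N)"
      using wb_step_measure[OF less.prems(1) assms(1) step] by simp
    moreover have "branching_tree n D (BTree N' (label T))"
      using step unfolding wb_step_def by blast
    ultimately show ?thesis
      using less.hyps[OF _ _ N'] wb_run_Cons[OF step] by (meson list.set_intros(2))
  qed
qed

theorem theorem2:
  fixes n :: nat
    and D :: "nat \<Rightarrow> 'v set"
    and F :: "(nat \<Rightarrow> 'v) set"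
    and f :: "(nat \<Rightarrow> 'v) \<Rightarrow> real"
    and c :: "(nat \<rightharpoonup> 'v) \<Rightarrow> ereal"
    and T :: "'v btree"
    and b :: ereal
  assumes "\<forall>j \<in> {1..n}. finite (D j) \<and> D j \<noteq> {}"
    and "relaxation_values n D F f c"
    and "branching_tree n D T"
    and "theta n D c T \<ge> b"
  shows "\<exists>Ts. wb_execution n D c Ts \<and>
           (\<exists>T' \<in> set Ts. branching_subtree n D T' T \<and> theta n D c T' \<ge> b)"
proof -
  \<comment> \<open>The provisional label of the root is already the one it has in
    \<open>T\<close>.\<close>
  let ?R = "BTree {[]} (label T)"
  have R: "branching_tree n D ?R" and "{[]} \<subseteq> nodes T"
    using assms(3) branching_tree_restrict[OF assms(3), of "{[]}"]
    unfolding branching_tree_def by auto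
  then obtain Ts where Ts: "wb_run n D c ?R Ts"
    and B: "\<exists>B \<in> set Ts. branching_subtree n D B T \<and> theta n D c T \<le> theta n D c B"
    using wb_run_reaches_bound[OF assms(1,3)] by blast
  have "wb_execution n D c Ts"
    using Ts R by (auto simp: wb_run_def wb_execution_def wb_initial_def)
  with B assms(4) show ?thesis
    using order_trans by blast
qed

end
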